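(* Let $N\ge3$ be odd, let $(\lambda_n)_{n\in\mathbb{Z}}$ be $N$-periodic non-vanishing variables with Poisson brackets $\{\lambda_m,\lambda_n\}=2(\delta_{m+1,n}-\delta_{m,n+1})\lambda_m\lambda_n$, and let $v_n,u_n$ be the $N$-periodic potentials determined by $$v_nv_{n+1}=\lambda_n,\qquad u_n=v_n+v_{n+1}^{-1}.$$ Put $\Phi_k=(-1)^k\operatorname{sign}k$ for $k\neq0$ and $\Phi_0=0$. Then for $|n-m|<N$ $$\{v_n,v_m\}=2\Phi_{n-m}v_nv_m\qquad\text{and}\qquad \{u_n,u_m\}=2\Phi_{n-m}u_nu_m+2(\delta_{m+1,n}-\delta_{m,n+1}).$$
   Context: The $u_n$ are the potentials of the $N$-periodic second order difference operator $\tau^2+u\tau+1$, where $(\tau\phi)_n=\phi_{n+1}$, factorized as $\tau^2+u\,\tau+1=(\tau+v)(\tau+v^{-1})$. In terms of a projective configuration $\eta_n=\phi_n/\psi_n$ of a pair of solutions one has $\lambda_n=\frac{\eta_{n+2}-\eta_{n+1}}{\eta_{n+1}-\eta_n}$. Since $N$ is odd, the $N$-periodic solution $v$ of $v_nv_{n+1}=\lambda_n$ exists and is unique up to a common sign; a branch of the resulting square root is fixed, and the brackets of $v_n$, $u_n$ are those induced from the brackets of the $\lambda_n$ by the Leibniz (chain) rule. Indices of $v,u,\lambda$ and the Kronecker deltas are understood modulo $N$. *)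

theory Defs
  imports "HOL-Analysis.Analysis" "HOL-Number_Theory.Cong"
begin

text \<open>
  The scalars range over any \<open>real_normed_field\<close>, so the real and the complex case are
  both covered. The phase space of the variables \<open>\<lambda>\<close> is the set of \<open>N\<close>-periodic sequences
  with the subspace topology of the product topology, i.e. a copy of the \<open>N\<close>-dimensional
  coordinate space; the variable \<open>\<lambda>\<^sub>n\<close> is the coordinate function \<open>\<lambda>x. x n\<close>.
\<close>

definition periodic_seqs :: "nat \<Rightarrow> (int \<Rightarrow> 'a) set" where
  "periodic_seqs N = {x. \<forall>n. x (n + int N) = x n}"

text \<open>Changing the \<open>i\<close>-th variable changes the sequence at every index congruent to \<open>i\<close>.\<close>

definition periodic_upd :: "nat \<Rightarrow> (int \<Rightarrow> 'a) \<Rightarrow> int \<Rightarrow> 'a \<Rightarrow> (int \<Rightarrow> 'a)" where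
  "periodic_upd N x i t = (\<lambda>k. if [k = i] (mod int N) then t else x k)"

definition partial_deriv ::
  "nat \<Rightarrow> int \<Rightarrow> ((int \<Rightarrow> 'a) \<Rightarrow> 'a) \<Rightarrow> (int \<Rightarrow> 'a) \<Rightarrow> 'a::real_normed_field" where
  "partial_deriv N i f x = deriv (\<lambda>t. f (periodic_upd N x i t)) (x i)"

text \<open>
  The bracket of two functions of the variables, obtained by the chain rule from the
  functions \<open>P i j\<close>, which are the brackets of the variables \<open>i, j \<in> {0..<N}\<close>.
  Skew-symmetry and the Jacobi identity are conditions on \<open>P\<close>; they hold automatically
  for the log-canonical brackets of the theorem.
\<close>

definition induced_bracket ::
  "nat \<Rightarrow> (int \<Rightarrow> int \<Rightarrow> (int \<Rightarrow> 'a) \<Rightarrow> 'a) \<Rightarrow> ((int \<Rightarrow> 'a) \<Rightarrow> 'a) \<Rightarrow> ((int \<Rightarrow> 'a) \<Rightarrow> 'a)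
    \<Rightarrow> (int \<Rightarrow> 'a) \<Rightarrow> 'a::real_normed_field" where
  "induced_bracket N P f g x =
     (\<Sum>i\<in>{0..<int N}. \<Sum>j\<in>{0..<int N}. partial_deriv N i f x * partial_deriv N j g x * P i j x)"

definition kdelta :: "nat \<Rightarrow> int \<Rightarrow> int \<Rightarrow> 'a::real_normed_field" where
  "kdelta N m n = (if [m = n] (mod int N) then 1 else 0)"

definition Phi :: "int \<Rightarrow> 'a::real_normed_field" where
  "Phi k = (if k = 0 then 0 else (- 1) powi k * of_int (sgn k))"

end

theory Submission
  imports Defs
begin

text \<open>
  The brackets of the \<open>v\<^sub>n\<close> need no explicit formula for \<open>v\<close>. Differentiating
  \<open>v\<^sub>n v\<^sub>n\<^sub>+\<^sub>1 = \<lambda>\<^sub>n\<close> shows that \<open>b n m = {v\<^sub>n, v\<^sub>m} / (v\<^sub>n v\<^sub>m)\<close> satisfies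
  \<open>b n m + b n (m + 1) + b (n + 1) m + b (n + 1) (m + 1) = 2 (\<delta> (n + 1) m - \<delta> n (m + 1))\<close>,
  which has only one solution that is \<open>N\<close>-periodic in both indices, because an \<open>N\<close>-periodic
  sequence with \<open>d\<^sub>n + d\<^sub>n\<^sub>+\<^sub>1 = 0\<close> vanishes for odd \<open>N\<close>. The \<open>N\<close>-periodic function
  \<open>F k = \<Phi> (k mod N)\<close> satisfies \<open>F k + F (k + 1) = \<delta> (k + 1) 0 - \<delta> k 0\<close>, so \<open>2 F (n - m)\<close> is
  this solution; the same identity gives the brackets of the \<open>u\<^sub>n\<close>.
\<close>

section \<open>Periodic and antiperiodic sequences\<close>

lemma periodic_shift:
  fixes f :: "int \<Rightarrow> 'b"
  assumes "\<And>n. f (n + p) = f n"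
  shows "f (n + z * p) = f n"
proof (induction z rule: int_induct[of _ 0])
  case (step1 i)
  then show ?case using assms[of "n + i * p"] by (simp add: algebra_simps)
next
  case (step2 i)
  then show ?case using assms[of "n + (i - 1) * p"] by (simp add: algebra_simps)
qed simp

lemma periodic_cong:
  fixes f :: "int \<Rightarrow> 'b"
  assumes "\<And>n. f (n + p) = f n" and "[k = l] (mod p)"
  shows "f k = f l"
proof -
  obtain z where "k = l + z * p"
    using assms(2) by (metis cong_iff_lin cong_sym mult.commute)
  then show ?thesis using periodic_shift[of f p, OF assms(1)] by simp
qed

text \<open>Each step flips the sign, so \<open>N\<close> steps multiply by
  \<open>(- 1) ^ N = - 1\<close>, while periodicity returns the same value; hence
  \<open>d n = - d n\<close>.\<close>

lemma antiperiodic_step_zero: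
  fixes d :: "int \<Rightarrow> 'a::field_char_0"
  assumes "odd N" and "\<And>n. d (n + int N) = d n" and step: "\<And>n. d n + d (n + 1) = 0"
  shows "d n = 0"
proof -
  have "d (n + int k) = (- 1) ^ k * d n" for k
  proof (induction k)
    case (Suc k)
    then show ?case using step[of "n + int k"]
      by (simp add: algebra_simps eq_neg_iff_add_eq_0)
  qed simp
  from this[of N] have "d n = - d n" using assms(1,2) by simp
  then show ?thesis by simp
qed

section \<open>Variation of a single variable\<close>

lemma periodic_upd_self:
  assumes "x \<in> periodic_seqs N"
  shows "periodic_upd N x i (x i) = x"
proof
  fix k
  have "x k = x i" if "[k = i] (mod int N)"
    by (rule periodic_cong[of x "int N", OF _ that]) (use assms in \<open>simp add: periodic_seqs_def\<close>)
  then show "periodic_upd N x i (x i) k = x k"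
    by (simp add: periodic_upd_def)
qed

lemma periodic_upd_in_periodic_seqs:
  assumes "x \<in> periodic_seqs N"
  shows "periodic_upd N x i t \<in> periodic_seqs N"
  using assms by (simp add: periodic_upd_def periodic_seqs_def cong_def)

lemma continuous_on_periodic_upd:
  "continuous_on S (\<lambda>t::'a::topological_space. periodic_upd N x i t)"
  unfolding periodic_upd_def
proof (rule continuous_on_coordinatewise_then_product)
  show "continuous_on S (\<lambda>t. if [k = i] (mod int N) then t else x k)" for k
    by (cases "[k = i] (mod int N)") auto
qed

text \<open>Relative openness suffices because an update never leaves the periodic sequences. The
  slice being open, identities that hold only on \<open>U\<close> can be differentiated in one
  variable.\<close>

lemma open_periodic_upd_preimage:
  fixes x :: "int \<Rightarrow> 'a::topological_space"
  assumes "openin (top_of_set (periodic_seqs N)) U" and "x \<in> U"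
  shows "open {t. periodic_upd N x i t \<in> U}"
proof -
  obtain V where "open V" and U: "U = periodic_seqs N \<inter> V"
    using assms(1) by (auto simp: openin_open)
  have "{t. periodic_upd N x i t \<in> U} = (\<lambda>t. periodic_upd N x i t) -` V"
    using assms(2) by (auto simp: U periodic_upd_in_periodic_seqs)
  moreover have "open ((\<lambda>t. periodic_upd N x i t) -` V)"
    using \<open>open V\<close> by (intro open_vimage continuous_on_periodic_upd)
  ultimately show ?thesis by simp
qed

lemma field_differentiable_periodic_upd:
  "(\<lambda>t. periodic_upd N x i t k) field_differentiable at t0"
  by (cases "[k = i] (mod int N)") (simp_all add: periodic_upd_def)

text \<open>The difference quotient of \<open>h\<close> is that of \<open>w\<close> times
  \<open>w t + w t0\<close>; by continuity this factor tends to \<open>2 * w t0\<close>, which is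
  nonzero, so it can be divided out.\<close>

lemma field_differentiable_sqrt:
  fixes w h :: "'a::real_normed_field \<Rightarrow> 'a"
  assumes S: "open S" "t0 \<in> S" and sq: "\<And>t. t \<in> S \<Longrightarrow> w t * w t = h t"
    and cont: "isCont w t0" and h: "h field_differentiable at t0" and nz: "w t0 \<noteq> 0"
  shows "w field_differentiable at t0"
proof -
  obtain h' where h': "((\<lambda>t. (h t - h t0) / (t - t0)) \<longlongrightarrow> h') (at t0)"
    using h by (auto simp: field_differentiable_def has_field_derivative_iff)
  have w: "(w \<longlongrightarrow> w t0) (at t0)"
    using cont by (simp add: isCont_def)
  have sum: "((\<lambda>t. w t + w t0) \<longlongrightarrow> w t0 + w t0) (at t0)"
    by (intro tendsto_intros w)
  have two_nz: "w t0 + w t0 \<noteq> 0"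
    using nz by (simp flip: mult_2)
  have "((\<lambda>t. (h t - h t0) / (t - t0) / (w t + w t0)) \<longlongrightarrow> h' / (w t0 + w t0)) (at t0)"
    by (intro tendsto_divide h' sum two_nz)
  moreover have "\<forall>\<^sub>F t in at t0.
      (h t - h t0) / (t - t0) / (w t + w t0) = (w t - w t0) / (t - t0)"
  proof -
    have "\<forall>\<^sub>F t in at t0. w t + w t0 \<noteq> 0"
      using sum two_nz by (rule tendsto_imp_eventually_ne)
    moreover have "\<forall>\<^sub>F t in at t0. t \<in> S"
      using S by (rule eventually_at_in_open')
    ultimately show ?thesis
    proof eventually_elim
      case (elim t)
      have "h t - h t0 = (w t - w t0) * (w t + w t0)"
        using sq[of t] sq[of t0] elim S by (simp add: algebra_simps)
      then show ?case using elim by simp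
    qed
  qed
  ultimately have "((\<lambda>t. (w t - w t0) / (t - t0)) \<longlongrightarrow> h' / (w t0 + w t0)) (at t0)"
    by (rule Lim_transform_eventually)
  then show ?thesis by (auto simp: field_differentiable_def has_field_derivative_iff)
qed

text \<open>Going once around the odd cycle in steps of two expresses \<open>w (n + 1)\<close> as a differentiable
  multiple of \<open>w n\<close>, so that \<open>w n * w (n + 1) = c n\<close> makes \<open>w n\<close> a square root.\<close>

lemma field_differentiable_cyclic_factors:
  fixes w c :: "int \<Rightarrow> 'a::real_normed_field \<Rightarrow> 'a"
  assumes "odd N" and S: "open S" "t0 \<in> S"
    and prod: "\<And>n t. t \<in> S \<Longrightarrow> w n t * w (n + 1) t = c n t"
    and nz: "\<And>n t. t \<in> S \<Longrightarrow> c n t \<noteq> 0"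
    and per: "\<And>n t. t \<in> S \<Longrightarrow> w (n + int N) t = w n t"
    and diff: "\<And>n. c n field_differentiable at t0"
    and cont: "\<And>n. isCont (w n) t0"
  shows "w n field_differentiable at t0"
proof -
  have w_nz: "w n t \<noteq> 0" if "t \<in> S" for n t
    using prod[OF that, of n] nz[OF that, of n] by auto
  have "\<exists>g. g field_differentiable at t0 \<and> (\<forall>t\<in>S. w (n + 2 * int k) t = g t * w n t)" for k
  proof (induction k)
    case 0
    then show ?case by (intro exI[of _ "\<lambda>_. 1"]) simp
  next
    case (Suc k)
    then obtain g where g: "g field_differentiable at t0"
      and eq: "\<And>t. t \<in> S \<Longrightarrow> w (n + 2 * int k) t = g t * w n t" by auto
    let ?j = "n + 2 * int k"
    have "w (n + 2 * int (Suc k)) t = c (?j + 1) t / c ?j t * g t * w n t" if t: "t \<in> S" for t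
    proof -
      have "w (?j + 2) t = c (?j + 1) t / c ?j t * w ?j t"
        using prod[OF t, of ?j] prod[OF t, of "?j + 1"] w_nz[OF t]
        by (simp add: field_simps flip: prod[OF t])
      then show ?thesis using eq[OF t] by (simp add: algebra_simps)
    qed
    moreover have "(\<lambda>t. c (?j + 1) t / c ?j t * g t) field_differentiable at t0"
      using nz S g by (intro field_differentiable_mult field_differentiable_divide diff) auto
    ultimately show ?case by blast
  qed
  \<comment> \<open>For odd \<open>N\<close> this many double steps advance the index by
    \<open>N + 1\<close>, which periodicity reduces to \<open>1\<close>.\<close>
  from this[of "(N + 1) div 2"] \<open>odd N\<close> obtain g where g: "g field_differentiable at t0"
    and eq: "\<And>t. t \<in> S \<Longrightarrow> w (n + (int N + 1)) t = g t * w n t"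
    by (auto elim!: oddE simp: algebra_simps)
  have eq1: "w (n + 1) t = g t * w n t" if "t \<in> S" for t
    using eq[OF that] per[OF that, of "n + 1"] by (simp add: algebra_simps)
  have g_nz: "g t \<noteq> 0" if "t \<in> S" for t
    using eq1[OF that] w_nz[OF that, of "n + 1"] by auto
  show ?thesis
  proof (rule field_differentiable_sqrt[OF S])
    show "w n t * w n t = c n t / g t" if "t \<in> S" for t
      using prod[OF that, of n] eq1[OF that] g_nz[OF that] by (simp add: field_simps)
    show "(\<lambda>t. c n t / g t) field_differentiable at t0"
      using g g_nz S by (intro field_differentiable_divide diff) auto
  qed (use cont w_nz S in auto)
qed

text \<open>The bracket at \<open>x\<close> sees a function only through its partial derivatives
  there. With scalars \<open>a\<close>, \<open>b\<close> evaluated at \<open>x\<close>, this form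
  covers both the Leibniz rule for \<open>v n * v (n + 1)\<close> and the chain rule for
  \<open>u n\<close>.\<close>

lemma induced_bracket_combine_left:
  assumes "\<And>i. partial_deriv N i f x = a * partial_deriv N i f1 x + b * partial_deriv N i f2 x"
  shows "induced_bracket N P f g x = a * induced_bracket N P f1 g x + b * induced_bracket N P f2 g x"
  unfolding induced_bracket_def assms
  by (simp add: algebra_simps sum.distrib sum_distrib_left)

lemma induced_bracket_combine_right:
  assumes "\<And>i. partial_deriv N i g x = a * partial_deriv N i g1 x + b * partial_deriv N i g2 x"
  shows "induced_bracket N P f g x = a * induced_bracket N P f g1 x + b * induced_bracket N P f g2 x"
  unfolding induced_bracket_def assms
  by (simp add: algebra_simps sum.distrib sum_distrib_left)

section \<open>The \<open>N\<close>-periodic extension of \<open>Phi\<close>\<close>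

text \<open>For negative \<open>k\<close> the residue is \<open>k + N\<close>: adding the odd
  \<open>N\<close> flips the parity factor, which makes up for the change of
  \<open>sgn\<close>.\<close>

lemma Phi_mod:
  assumes "odd N" and "\<bar>k\<bar> < int N"
  shows "Phi k = (Phi (k mod int N) :: 'a::real_normed_field)"
proof (cases "k < 0")
  case True
  then have "k mod int N = k + int N"
    using mod_pos_pos_trivial[of "k + int N" "int N"] assms(2) by simp
  then show ?thesis
    using True assms by (simp add: Phi_def power_int_add)
next
  case False
  then show ?thesis using assms by simp
qed

text \<open>Consecutive alternating values cancel except around the residue \<open>0\<close>, where
  \<open>Phi\<close> vanishes: its neighbours are \<open>Phi 1 = - 1\<close> and
  \<open>Phi (N - 1) = 1\<close>, as \<open>N - 1\<close> is even.\<close>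

lemma Phi_mod_add_Suc:
  assumes "odd N" and "N \<ge> 3"
  shows "Phi (k mod int N) + Phi ((k + 1) mod int N)
    = (kdelta N (k + 1) 0 - kdelta N k 0 :: 'a::real_normed_field)"
proof -
  define r where "r = k mod int N"
  have r: "0 \<le> r" "r < int N" using assms by (auto simp: r_def)
  have Suc_r: "(k + 1) mod int N = (if r + 1 = int N then 0 else r + 1)"
    using r mod_add_left_eq[of k "int N" 1] by (auto simp: r_def[symmetric] mod_pos_pos_trivial)
  consider "r = 0" | "r + 1 = int N" "r > 0" | "r > 0" "r + 1 < int N"
    using r by linarith
  then show ?thesis
  proof cases
    case 1
    then show ?thesis using assms Suc_r by (simp add: kdelta_def cong_def Phi_def flip: r_def)
  next
    case 2
    then have "even r" using assms(1) by (metis even_of_nat odd_one odd_add)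
    then show ?thesis using 2 Suc_r
      by (simp add: kdelta_def cong_def Phi_def power_int_minus_left flip: r_def)
  next
    case 3
    then show ?thesis using Suc_r
      by (simp add: kdelta_def cong_def Phi_def power_int_add flip: r_def)
  qed
qed

lemma kdelta_diff: "kdelta N m n = kdelta N (m - n) 0"
  by (simp add: kdelta_def cong_diff_iff_cong_0)

lemma kdelta_commute: "kdelta N m n = kdelta N n m"
  by (simp add: kdelta_def cong_sym_eq)

theorem proposition3p4:
  fixes N :: nat
    and U :: "(int \<Rightarrow> 'a::real_normed_field) set"
    and P :: "int \<Rightarrow> int \<Rightarrow> (int \<Rightarrow> 'a) \<Rightarrow> 'a"
    and v u :: "int \<Rightarrow> (int \<Rightarrow> 'a) \<Rightarrow> 'a"
  assumes "N \<ge> 3" and "odd N"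
    and "openin (top_of_set (periodic_seqs N)) U"
    and "\<And>x n. x \<in> U \<Longrightarrow> x n \<noteq> 0"
    and "\<And>x m n. x \<in> U \<Longrightarrow>
           induced_bracket N P (\<lambda>y. y m) (\<lambda>y. y n) x
             = 2 * (kdelta N (m + 1) n - kdelta N m (n + 1)) * x m * x n"
    and "\<And>n. continuous_on U (v n)"
    and "\<And>x n. x \<in> U \<Longrightarrow> v (n + int N) x = v n x"
    and "\<And>x n. x \<in> U \<Longrightarrow> v n x * v (n + 1) x = x n"
    and "\<And>x n. x \<in> U \<Longrightarrow> u n x = v n x + inverse (v (n + 1) x)"
  shows "\<forall>x\<in>U. \<forall>n m. \<bar>n - m\<bar> < int N \<longrightarrow>
           induced_bracket N P (v n) (v m) x = 2 * Phi (n - m) * v n x * v m x \<and>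
           induced_bracket N P (u n) (u m) x
             = 2 * Phi (n - m) * u n x * u m x
               + 2 * (kdelta N (m + 1) n - kdelta N m (n + 1))"
proof (intro ballI allI impI)
  fix x n m assume x: "x \<in> U" and nm: "\<bar>n - m\<bar> < int N"
  note N = assms(1,2) and per = assms(7) and prod = assms(8) and u = assms(9)
  have "U \<subseteq> periodic_seqs N"
    using assms(3) openin_imp_subset by blast
  then have x_per: "x \<in> periodic_seqs N"
    using x by blast
  have v_nz: "v n y \<noteq> 0" if "y \<in> U" for n y
    using prod[OF that, of n] assms(4)[OF that, of n] by auto
  let ?S = "\<lambda>i. {t. periodic_upd N x i t \<in> U}"
  have S: "open (?S i)" "x i \<in> ?S i" for i
    using open_periodic_upd_preimage[OF assms(3) x] x periodic_upd_self[OF x_per] by auto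
  let ?v = "\<lambda>n i t. v n (periodic_upd N x i t)"
  have v_cont: "isCont (?v n i) (x i)" for n i
  proof -
    have "continuous_on (?S i) (?v n i)"
      using assms(6) by (rule continuous_on_compose2) (auto intro: continuous_on_periodic_upd)
    then show ?thesis using S by (simp add: continuous_on_eq_continuous_at)
  qed
  \<comment> \<open>The branch is only assumed continuous; differentiability along each variable
    comes from the cyclic product relations on the slice.\<close>
  have "?v n i field_differentiable at (x i)" for n i
    by (rule field_differentiable_cyclic_factors[where c = "\<lambda>n t. periodic_upd N x i t n",
          OF N(2) S[of i]])
      (use assms(4) per prod v_cont field_differentiable_periodic_upd in auto)
  then have v_deriv: "(?v n i has_field_derivative partial_deriv N i (v n) x) (at (x i))" for n i
    unfolding partial_deriv_def by (simp add: DERIV_deriv_iff_field_differentiable)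
  have pd_coord: "partial_deriv N i (\<lambda>y. y n) x
      = v (n + 1) x * partial_deriv N i (v n) x + v n x * partial_deriv N i (v (n + 1)) x" for n i
  proof -
    have "((\<lambda>t. ?v n i t * ?v (n + 1) i t) has_field_derivative
        (v (n + 1) x * partial_deriv N i (v n) x + v n x * partial_deriv N i (v (n + 1)) x)) (at (x i))"
      by (rule derivative_eq_intros v_deriv)+ (simp add: periodic_upd_self[OF x_per])
    then have "((\<lambda>t. periodic_upd N x i t n) has_field_derivative
        (v (n + 1) x * partial_deriv N i (v n) x + v n x * partial_deriv N i (v (n + 1)) x)) (at (x i))"
      by (rule has_field_derivative_transform_within_open[OF _ S]) (use prod in auto)
    then show ?thesis
      unfolding partial_deriv_def by (rule DERIV_imp_deriv)
  qed
  \<comment> \<open>The factor \<open>1\<close> and the added negative coefficient match the shape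
    of the combination lemmas.\<close>
  have pd_u: "partial_deriv N i (u n) x
      = 1 * partial_deriv N i (v n) x + (- inverse (v (n + 1) x ^ 2)) * partial_deriv N i (v (n + 1)) x" for n i
  proof -
    have "((\<lambda>t. ?v n i t + inverse (?v (n + 1) i t)) has_field_derivative
        (1 * partial_deriv N i (v n) x + (- inverse (v (n + 1) x ^ 2)) * partial_deriv N i (v (n + 1)) x)) (at (x i))"
      by (rule derivative_eq_intros v_deriv)+
        (auto simp: periodic_upd_self[OF x_per] v_nz[OF x] power2_eq_square)
    then have "((\<lambda>t. u n (periodic_upd N x i t)) has_field_derivative
        (1 * partial_deriv N i (v n) x + (- inverse (v (n + 1) x ^ 2)) * partial_deriv N i (v (n + 1)) x)) (at (x i))"
      by (rule has_field_derivative_transform_within_open[OF _ S]) (use u in auto)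
    then show ?thesis
      unfolding partial_deriv_def by (rule DERIV_imp_deriv)
  qed

  \<comment> \<open>Brackets of the \<open>v n\<close>\<close>
  define B where "B n m = induced_bracket N P (v n) (v m) x" for n m
  define F :: "int \<Rightarrow> 'a" where "F k = Phi (k mod int N)" for k
  have F_per: "F (k + int N) = F k" for k
    by (simp add: F_def)
  have F_Suc: "F (k + 1) = kdelta N (k + 1) 0 - kdelta N k 0 - F k" for k
    using Phi_mod_add_Suc[OF N(2,1), of k, where 'a = 'a] by (simp add: F_def algebra_simps)
  have B_per: "B (n + int N) m = B n m" "B n (m + int N) = B n m" for n m
  proof -
    \<comment> \<open>\<open>v (n + int N)\<close> and \<open>v n\<close> agree only on
      \<open>U\<close>, so their derivatives are compared on the open slice.\<close>
    have "partial_deriv N i (v (n + int N)) x = partial_deriv N i (v n) x" for i n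
    proof -
      have "(?v n i has_field_derivative partial_deriv N i (v (n + int N)) x) (at (x i))"
        by (rule has_field_derivative_transform_within_open[OF v_deriv S]) (use per in auto)
      then show ?thesis using v_deriv DERIV_unique by blast
    qed
    then show "B (n + int N) m = B n m" "B n (m + int N) = B n m"
      by (simp_all add: B_def induced_bracket_def)
  qed
  define d where "d n m = B n m / (v n x * v m x) - 2 * F (n - m)" for n m
  \<comment> \<open>The grouping exhibits the sum as \<open>e n + e (n + 1)\<close> with
    \<open>e n = d n m + d n (m + 1)\<close>, ready for the antiperiodicity argument in
    \<open>n\<close>.\<close>
  have d_sum: "d n m + d n (m + 1) + (d (n + 1) m + d (n + 1) (m + 1)) = 0" for n m
  proof -
    \<comment> \<open>Leibniz expansion of the bracket of two coordinates in both arguments;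
      dividing by the product of the two coordinates then gives the normalised recurrence.\<close>
    have "v (n + 1) x * (v (m + 1) x * B n m + v m x * B n (m + 1))
        + v n x * (v (m + 1) x * B (n + 1) m + v m x * B (n + 1) (m + 1))
        = induced_bracket N P (\<lambda>y. y n) (\<lambda>y. y m) x"
      by (simp add: B_def induced_bracket_combine_left[OF pd_coord]
          induced_bracket_combine_right[OF pd_coord])
    also have "\<dots> = 2 * (kdelta N (n + 1) m - kdelta N n (m + 1))
        * (v n x * v (n + 1) x) * (v m x * v (m + 1) x)"
      using assms(5)[OF x] prod[OF x] by simp
    finally have "(B n m / (v n x * v m x) + B n (m + 1) / (v n x * v (m + 1) x)
        + (B (n + 1) m / (v (n + 1) x * v m x) + B (n + 1) (m + 1) / (v (n + 1) x * v (m + 1) x)))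
          * (v n x * v (n + 1) x * (v m x * v (m + 1) x))
        = 2 * (kdelta N (n + 1) m - kdelta N n (m + 1))
          * (v n x * v (n + 1) x * (v m x * v (m + 1) x))"
      using v_nz[OF x] by (simp add: distrib_left distrib_right ac_simps)
    then have "B n m / (v n x * v m x) + B n (m + 1) / (v n x * v (m + 1) x)
        + (B (n + 1) m / (v (n + 1) x * v m x) + B (n + 1) (m + 1) / (v (n + 1) x * v (m + 1) x))
        = 2 * (kdelta N (n + 1) m - kdelta N n (m + 1))"
      using v_nz[OF x] by (subst (asm) mult_cancel_right) auto
    \<comment> \<open>Adding the recurrence of \<open>F\<close> at \<open>n - m\<close> and at
      \<open>n - m - 1\<close> cancels the middle delta.\<close>
    moreover have "F (n - m) + F (n - (m + 1)) + (F (n + 1 - m) + F (n + 1 - (m + 1)))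
        = kdelta N (n + 1) m - kdelta N n (m + 1)"
      using F_Suc[of "n - m"] F_Suc[of "n - m - 1"]
        kdelta_diff[of N "n + 1" m, where 'a = 'a] kdelta_diff[of N n "m + 1", where 'a = 'a]
      by (simp add: diff_diff_eq add_diff_eq diff_add_eq del: add_diff_cancel)
    ultimately show ?thesis
      unfolding d_def by algebra
  qed
  have d_per: "d (n + int N) m = d n m" "d n (m + int N) = d n m" for n m
    using B_per per[OF x] F_per[of "n - m"] F_per[of "n - m - int N"]
    by (simp_all add: d_def algebra_simps)
  \<comment> \<open>The antiperiodicity argument runs first in \<open>n\<close>, then in
    \<open>m\<close>.\<close>
  have "d n m + d n (m + 1) = 0" for n m
    by (rule antiperiodic_step_zero[OF N(2), of "\<lambda>n. d n m + d n (m + 1)"])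
      (simp_all only: d_per d_sum)
  then have "d n m = 0" for n m
    by (rule antiperiodic_step_zero[OF N(2), of "d n", OF d_per(2)])
  then have B: "B n m = 2 * F (n - m) * v n x * v m x" for n m
    using v_nz[OF x] by (simp add: d_def field_simps)
  \<comment> \<open>The bound on \<open>n - m\<close> enters here, to replace the periodic
    \<open>F\<close> by \<open>Phi\<close>.\<close>
  have Phi_F: "Phi (n - m) = F (n - m)"
    using Phi_mod[OF N(2) nm] by (simp add: F_def)

  \<comment> \<open>Brackets of the \<open>u n\<close>\<close>
  have bracket_u: "induced_bracket N P (u n) (u m) x
      = B n m - B n (m + 1) / v (m + 1) x ^ 2
        - (B (n + 1) m - B (n + 1) (m + 1) / v (m + 1) x ^ 2) / v (n + 1) x ^ 2"
    by (simp add: B_def induced_bracket_combine_left[OF pd_u]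
        induced_bracket_combine_right[OF pd_u] divide_inverse algebra_simps)
  \<comment> \<open>These are the cross terms of \<open>u n x * u m x\<close>; in the bracket they
    carry \<open>F\<close> at neighbouring arguments, which have to be turned into
    \<open>F (n - m)\<close>.\<close>
  let ?a = "v m x / v (n + 1) x" and ?b = "v n x / v (m + 1) x"
  have v_cong: "v k x = v l x" if "[k = l] (mod int N)" for k l
    using periodic_cong[of "\<lambda>k. v k x" "int N", OF per[OF x] that] .
  have "F (n - m) + F (n + 1 - m) = kdelta N m (n + 1) - kdelta N n m"
    using F_Suc[of "n - m"] kdelta_diff[of N "n + 1" m, where 'a = 'a]
      kdelta_diff[of N n m, where 'a = 'a] kdelta_commute[of N m "n + 1", where 'a = 'a]
    by (simp add: algebra_simps)
  moreover have "F (n - m) + F (n - (m + 1)) = kdelta N n m - kdelta N (m + 1) n"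
    using F_Suc[of "n - m - 1"] kdelta_diff[of N n "m + 1", where 'a = 'a]
      kdelta_diff[of N n m, where 'a = 'a] kdelta_commute[of N "m + 1" n, where 'a = 'a]
    by (simp add: algebra_simps)
  \<comment> \<open>Where the respective delta is nonzero, \<open>?a\<close> or \<open>?b\<close>
    equals \<open>1\<close>; for n and m congruent, \<open>?a = ?b\<close>, so the diagonal deltas
    cancel in \<open>key\<close>.\<close>
  moreover have "kdelta N m (n + 1) * ?a = kdelta N m (n + 1)"
    using v_cong[of m "n + 1"] v_nz[OF x] by (simp add: kdelta_def)
  moreover have "kdelta N (m + 1) n * ?b = kdelta N (m + 1) n"
    using v_cong[of "m + 1" n] v_nz[OF x] by (simp add: kdelta_def)
  moreover have "kdelta N n m * ?a = kdelta N n m * ?b"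
    using v_cong[of n m] v_cong[of "n + 1" "m + 1"] cong_add[of n m "int N" 1 1]
    by (simp add: kdelta_def)
  ultimately have key: "- F (n + 1 - m) * ?a - F (n - (m + 1)) * ?b
      = F (n - m) * (?a + ?b) + (kdelta N (m + 1) n - kdelta N m (n + 1))"
    by algebra
  have "induced_bracket N P (u n) (u m) x
      = 2 * (F (n - m) * (v n x * v m x + inverse (v (n + 1) x) * inverse (v (m + 1) x))
          + (- F (n + 1 - m) * ?a - F (n - (m + 1)) * ?b))"
    unfolding bracket_u B using v_nz[OF x]
    by (simp add: field_simps power2_eq_square)
  also have "\<dots> = 2 * F (n - m) * u n x * u m x + 2 * (kdelta N (m + 1) n - kdelta N m (n + 1))"
    unfolding key u[OF x] by (simp add: divide_inverse algebra_simps)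
  finally show "induced_bracket N P (v n) (v m) x = 2 * Phi (n - m) * v n x * v m x \<and>
      induced_bracket N P (u n) (u m) x
        = 2 * Phi (n - m) * u n x * u m x + 2 * (kdelta N (m + 1) n - kdelta N m (n + 1))"
    using B by (simp add: B_def Phi_F)
qed

end
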